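(* Let $(\Omega,d,\mu)$ be a metric measure space and let $X,Y$ be two rearrangement invariant (r.i.) spaces on $\Omega$ with fundamental functions $\varphi_X,\varphi_Y$ (normalized as described in the context). Let $$\Psi(t)=\frac{\varphi_X(t)}{\varphi_Y(t)}.$$ Suppose there exists a continuous increasing function $g:[1,\infty)\to[1,\infty)$ with $g(1)=1$ such that $$\Psi\!\left(\frac1t\right)\ge g(t)\qquad (t\ge 1)$$ and $$\lim_{t\to\infty}\frac{t\,g(t)}{g(e^{t})}=0 .$$ If $(\Omega,d,\mu)$ admits an $(X,Y)$-Poincaré inequality, then the measure $\mu$ is doubling.
   Context: A metric measure space $(\Omega,d,\mu)$ is a metric space $(\Omega,d)$ with a Borel measure $\mu$ such that $0<\mu(B)<\infty$ for every ball $B=B(x,r)=\{y\in\Omega: d(x,y)<r\}$. For $\sigma>0$, $\sigma B:=B(x,\sigma r)$ (balls come with a specified center and radius). The measure $\mu$ is doubling if there is a constant $C>0$ such that $\mu(2B)\le C\mu(B)$ for all balls $B\subset\Omega$. A Borel function $\rho:\Omega\to[0,\infty]$ is an upper gradient of $f$ if $|f(x)-f(y)|\le\int_\gamma \rho\,ds$ for all $x,y\in\Omega$ and all rectifiable curves $\gamma$ joining $x$ and $y$. For a measurable $f:\Omega\to\mathbb{R}$, $\mu_f(t)=\mu\{x\in\Omega:|f(x)|>t\}$ for $t\ge 0$, and the decreasing rearrangement is $f_\mu^*(s)=\inf\{t\ge0:\mu_f(t)\le s\}$, $s\ge 0$. A r.i. space $X$ on $\Omega$ is a Banach function space with the Fatou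 property such that if $g\in X$ and $f_\mu^*=g_\mu^*$ then $f\in X$ and $\|f\|_X=\|g\|_X$. Its representation space $\bar X$ is a r.i. space on $(0,\mu(\Omega))$ with Lebesgue measure such that $\|f\|_X=\|f_\mu^*\|_{\bar X}$ for every $f\in X$; $\bar X(0,1)$ denotes the representation space with its function norm restricted to (functions on) $(0,1)$. The fundamental function of $X$ is $\varphi_X(s)=\|\chi_E\|_X$, where $E\subset\Omega$ is any measurable set with $\mu(E)=s$; equivalently $\varphi_X(s)=\|\chi_{(0,s)}\|_{\bar X}$. It is assumed for all r.i. spaces considered that $\varphi_X$ is concave, $\varphi_X(1)=1$ (this can be achieved by renorming) and $\varphi_X(0)=0$. For a ball $B\subset\Omega$ put $\mu_B=\mu(B)^{-1}\mu$ and, for $f\in L^1_{loc}(\Omega)$, $$\|f\|_{X(B,\mu_B)}:=\left\|(f\chi_B)_\mu^*(s\,\mu(B))\right\|_{\bar X(0,1)},$$ where the norm is taken in the variable $s\in(0,1)$. Write $f_B=\frac1{\mu(B)}\int_B f\,d\mu$; here $L^1_{loc}(\Omega)$ consists of functions integrable on balls. $(\Omega,d,\mu)$ admits an $(X,Y)$-Poincaré inequality if there exist constants $C_S,\sigma\ge1$ such that $$\|f-f_B\|_{X(B,\mu_B)}\le C_S\, r\,\|\rho\|_{Y(\sigma B,\mu_{\sigma B})}$$ whenever $B$ is a ball of radius $r\in(0,\infty)$, $f\in L^1_{loc}(\Omega)$ and $\rho:\Omega\to[0,\infty]$ is an upper gradient of $f$. *)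

theory Defs
  imports "HOL-Analysis.Analysis"
begin

section \<open>Metric measure spaces\<close>

definition metric_measure_space :: "'a::metric_space measure \<Rightarrow> bool" where
  "metric_measure_space \<mu> \<longleftrightarrow>
     sets \<mu> = sets borel \<and>
     (\<forall>x. \<forall>r>0. 0 < emeasure \<mu> (ball x r) \<and> emeasure \<mu> (ball x r) < \<infinity>)"

definition doubling_measure :: "'a::metric_space measure \<Rightarrow> bool" where
  "doubling_measure \<mu> \<longleftrightarrow>
     (\<exists>C>0. \<forall>x. \<forall>r>0. emeasure \<mu> (ball x (2 * r)) \<le> ennreal C * emeasure \<mu> (ball x r))"

section \<open>Curves and upper gradients\<close>

text \<open>The supremum is over all partitions \<open>a = t 0 \<le> \<dots> \<le> t n = b\<close>.\<close>

definition curve_length :: "(real \<Rightarrow> 'a::metric_space) \<Rightarrow> real \<Rightarrow> real \<Rightarrow> ennreal" where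
  "curve_length \<gamma> a b =
     (SUP (n, t) \<in> {(n::nat, t::nat \<Rightarrow> real). mono_on {..n} t \<and> t 0 = a \<and> t n = b}.
        ennreal (\<Sum>i<n. dist (\<gamma> (t i)) (\<gamma> (t (Suc i)))))"

definition rectifiable_curve :: "(real \<Rightarrow> 'a::metric_space) \<Rightarrow> bool" where
  "rectifiable_curve \<gamma> \<longleftrightarrow> path \<gamma> \<and> curve_length \<gamma> 0 1 < \<infinity>"

text \<open>For a rectifiable \<open>\<gamma>\<close> the function \<open>u \<mapsto> curve_length \<gamma> 0 u\<close> is continuous and nondecreasing,
  and \<open>\<gamma>\<close> is constant on each of its level sets. So for \<open>0 \<le> s \<le> curve_length \<gamma> 0 1\<close> the value below
  exists and does not depend on the choice of \<open>u\<close>.\<close>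

definition arc_length_param :: "(real \<Rightarrow> 'a::metric_space) \<Rightarrow> real \<Rightarrow> 'a" where
  "arc_length_param \<gamma> s = \<gamma> (SOME u. u \<in> {0..1} \<and> curve_length \<gamma> 0 u = ennreal s)"

definition curve_integral :: "(real \<Rightarrow> 'a::metric_space) \<Rightarrow> ('a \<Rightarrow> ennreal) \<Rightarrow> ennreal" where
  "curve_integral \<gamma> \<rho> =
     (\<integral>\<^sup>+ s \<in> {0..enn2real (curve_length \<gamma> 0 1)}. \<rho> (arc_length_param \<gamma> s) \<partial>lborel)"

definition upper_gradient :: "('a::metric_space \<Rightarrow> real) \<Rightarrow> ('a \<Rightarrow> ennreal) \<Rightarrow> bool" where
  "upper_gradient f \<rho> \<longleftrightarrow>
     \<rho> \<in> borel_measurable borel \<and>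
     (\<forall>x y \<gamma>. rectifiable_curve \<gamma> \<and> pathstart \<gamma> = x \<and> pathfinish \<gamma> = y \<longrightarrow>
        ennreal \<bar>f x - f y\<bar> \<le> curve_integral \<gamma> \<rho>)"

section \<open>Rearrangement invariant spaces\<close>

text \<open>The infimum may be taken over \<open>t\<close> in \<open>[0, \<infinity>]\<close>, as \<open>t = \<infinity>\<close> always satisfies the condition; this
  gives \<open>\<infinity>\<close> when no finite \<open>t\<close> does. The rearrangement of a real-valued \<open>f\<close> is obtained by
  applying the definition to \<open>\<bar>f\<bar>\<close>.\<close>

definition distribution_fun :: "'b measure \<Rightarrow> ('b \<Rightarrow> ennreal) \<Rightarrow> ennreal \<Rightarrow> ennreal" where
  "distribution_fun M f t = emeasure M {x \<in> space M. t < f x}"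

definition rearrangement :: "'b measure \<Rightarrow> ('b \<Rightarrow> ennreal) \<Rightarrow> real \<Rightarrow> ennreal" where
  "rearrangement M f s = Inf {t. distribution_fun M f t \<le> ennreal s}"

text \<open>A Banach function space with the Fatou property (Bennett--Sharpley) is represented by its
  function norm \<open>N\<close> on the measurable functions with values in \<open>[0, \<infinity>]\<close>; the space consists of the
  measurable \<open>f\<close> with \<open>N \<bar>f\<bar> < \<infinity>\<close>.\<close>

definition banach_function_norm :: "'b measure \<Rightarrow> (('b \<Rightarrow> ennreal) \<Rightarrow> ennreal) \<Rightarrow> bool" where
  "banach_function_norm M N \<longleftrightarrow>
     (\<forall>f\<in>borel_measurable M. N f = 0 \<longleftrightarrow> (AE x in M. f x = 0)) \<and>
     (\<forall>f\<in>borel_measurable M. \<forall>a\<ge>0. N (\<lambda>x. ennreal a * f x) = ennreal a * N f) \<and>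
     (\<forall>f\<in>borel_measurable M. \<forall>g\<in>borel_measurable M. N (\<lambda>x. f x + g x) \<le> N f + N g) \<and>
     (\<forall>f\<in>borel_measurable M. \<forall>g\<in>borel_measurable M. (AE x in M. g x \<le> f x) \<longrightarrow> N g \<le> N f) \<and>
     (\<forall>F. \<forall>f\<in>borel_measurable M. (\<forall>n::nat. F n \<in> borel_measurable M) \<and>
        (AE x in M. incseq (\<lambda>n. F n x) \<and> (SUP n. F n x) = f x) \<longrightarrow> (SUP n. N (F n)) = N f) \<and>
     (\<forall>E\<in>sets M. emeasure M E < \<infinity> \<longrightarrow> N (indicator E) < \<infinity>) \<and>
     (\<forall>E\<in>sets M. emeasure M E < \<infinity> \<longrightarrow>
        (\<exists>C. \<forall>f\<in>borel_measurable M. (\<integral>\<^sup>+ x \<in> E. f x \<partial>M) \<le> ennreal C * N f))"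

definition ri_norm :: "'b measure \<Rightarrow> (('b \<Rightarrow> ennreal) \<Rightarrow> ennreal) \<Rightarrow> bool" where
  "ri_norm M N \<longleftrightarrow>
     banach_function_norm M N \<and>
     (\<forall>f\<in>borel_measurable M. \<forall>g\<in>borel_measurable M.
        N g < \<infinity> \<and> (\<forall>s\<ge>0. rearrangement M f s = rearrangement M g s) \<longrightarrow> N f = N g)"

definition lebesgue_interval :: "'b measure \<Rightarrow> real measure" where
  "lebesgue_interval M = restrict_space lborel {s. 0 < s \<and> ennreal s < emeasure M (space M)}"

definition representation_norm ::
  "'b measure \<Rightarrow> (('b \<Rightarrow> ennreal) \<Rightarrow> ennreal) \<Rightarrow> ((real \<Rightarrow> ennreal) \<Rightarrow> ennreal) \<Rightarrow> bool" where
  "representation_norm M N Nbar \<longleftrightarrow>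
     ri_norm (lebesgue_interval M) Nbar \<and>
     (\<forall>f\<in>borel_measurable M. N f < \<infinity> \<longrightarrow> N f = Nbar (rearrangement M f))"

text \<open>The fundamental function is expressed through the representation norm, so that it is defined
  also at those \<open>s\<close> that are not the measure of any set; see \<open>fundamental_function_eq\<close> below.\<close>

definition fundamental_function :: "((real \<Rightarrow> ennreal) \<Rightarrow> ennreal) \<Rightarrow> real \<Rightarrow> real" where
  "fundamental_function Nbar s = enn2real (Nbar (indicator {0<..<s}))"

definition normalized_fundamental :: "'b measure \<Rightarrow> ((real \<Rightarrow> ennreal) \<Rightarrow> ennreal) \<Rightarrow> bool" where
  "normalized_fundamental M Nbar \<longleftrightarrow>
     concave_on {s. 0 \<le> s \<and> ennreal s \<le> emeasure M (space M)} (fundamental_function Nbar) \<and>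
     fundamental_function Nbar 1 = 1 \<and>
     fundamental_function Nbar 0 = 0"

lemma rearrangement_indicator:
  assumes "E \<in> sets M" and "s \<ge> 0"
  shows "rearrangement M (indicator E) s = (if ennreal s < emeasure M E then 1 else 0)"
proof -
  have E: "{x \<in> space M. t < indicator E x} = (if t < 1 then E else {})" for t :: ennreal
    using sets.sets_into_space[OF assms(1)] by (auto simp: indicator_def split: if_splits)
  have "{t. distribution_fun M (indicator E) t \<le> ennreal s} =
      (if ennreal s < emeasure M E then {1..} else UNIV)"
    by (auto simp: distribution_fun_def E not_less split: if_splits)
  then show ?thesis
    by (simp add: rearrangement_def flip: bot_ennreal)
qed

lemma fundamental_function_eq:
  assumes N: "banach_function_norm M N" and R: "representation_norm M N Nbar"
    and E: "E \<in> sets M" "emeasure M E < \<infinity>"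
  shows "N (indicator E) = ennreal (fundamental_function Nbar (measure M E))"
proof -
  let ?L = "lebesgue_interval M"
  let ?I = "indicator {0<..<measure M E} :: real \<Rightarrow> ennreal"
  have B: "banach_function_norm ?L Nbar"
    using R by (simp add: representation_norm_def ri_norm_def)
  have fin: "N (indicator E) < \<infinity>"
    using N E unfolding banach_function_norm_def by blast
  have eq: "N (indicator E) = Nbar (rearrangement M (indicator E))"
    using R fin E by (simp add: representation_norm_def)
  have mI: "?I \<in> borel_measurable ?L"
    unfolding lebesgue_interval_def by (intro measurable_restrict_space1) simp
  have pt: "rearrangement M (indicator E) s = ?I s" if "s \<in> space ?L" for s
  proof -
    have "s > 0" using that by (auto simp: lebesgue_interval_def space_restrict_space)
    moreover have "emeasure M E = ennreal (measure M E)"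
      using E by (simp add: emeasure_eq_ennreal_measure less_top)
    ultimately show ?thesis
      using E by (simp add: rearrangement_indicator indicator_def ennreal_less_iff)
  qed
  have mR: "rearrangement M (indicator E) \<in> borel_measurable ?L"
    using mI by (subst measurable_cong[OF pt])
  have mono: "\<forall>f\<in>borel_measurable ?L. \<forall>g\<in>borel_measurable ?L.
      (AE x in ?L. g x \<le> f x) \<longrightarrow> Nbar g \<le> Nbar f"
    using B unfolding banach_function_norm_def by blast
  have "Nbar (rearrangement M (indicator E)) = Nbar ?I"
    using mono mI mR pt by (intro antisym) (simp_all add: AE_I2)
  with eq fin show ?thesis
    by (simp add: fundamental_function_def)
qed

section \<open>Poincare inequalities\<close>

text \<open>The norm \<open>\<parallel>h\<parallel>\<close> in the space localized to a ball \<open>B\<close> with the normalized measure. Functions on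
  \<open>(0, 1)\<close> are extended by zero. If the total mass is less than \<open>1\<close>, the representation norm only
  sees their values on \<open>(0, \<mu>(\<Omega>))\<close>.\<close>

definition ball_norm ::
  "'a measure \<Rightarrow> ((real \<Rightarrow> ennreal) \<Rightarrow> ennreal) \<Rightarrow> 'a set \<Rightarrow> ('a \<Rightarrow> ennreal) \<Rightarrow> ennreal" where
  "ball_norm \<mu> Nbar B h =
     Nbar (\<lambda>s. indicator {0<..<1} s *
       rearrangement \<mu> (\<lambda>y. h y * indicator B y) (s * measure \<mu> B))"

definition L1_loc :: "'a::metric_space measure \<Rightarrow> ('a \<Rightarrow> real) set" where
  "L1_loc \<mu> = {f \<in> borel_measurable \<mu>. \<forall>x. \<forall>r>0. set_integrable \<mu> (ball x r) f}"

definition average :: "'a measure \<Rightarrow> 'a set \<Rightarrow> ('a \<Rightarrow> real) \<Rightarrow> real" where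
  "average \<mu> B f = (LINT y:B|\<mu>. f y) / measure \<mu> B"

definition admits_Poincare ::
  "'a::metric_space measure \<Rightarrow> ((real \<Rightarrow> ennreal) \<Rightarrow> ennreal) \<Rightarrow> ((real \<Rightarrow> ennreal) \<Rightarrow> ennreal) \<Rightarrow> bool"
where
  "admits_Poincare \<mu> Xbar Ybar \<longleftrightarrow>
     (\<exists>C\<^sub>S \<sigma>. C\<^sub>S \<ge> 1 \<and> \<sigma> \<ge> 1 \<and>
        (\<forall>x. \<forall>r>0. \<forall>f\<in>L1_loc \<mu>. \<forall>\<rho>. upper_gradient f \<rho> \<longrightarrow>
           ball_norm \<mu> Xbar (ball x r) (\<lambda>y. ennreal \<bar>f y - average \<mu> (ball x r) f\<bar>)
             \<le> ennreal (C\<^sub>S * r) * ball_norm \<mu> Ybar (ball x (\<sigma> * r)) \<rho>))"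

end

theory Submission
  imports Defs
begin

text \<open>Fix \<open>x\<close>, \<open>r\<close> and put \<open>R = 2 r\<close>, \<open>m s = \<mu>(B(x, s)) / \<mu>(B(x, R))\<close>. For \<open>r\<^sub>1 < r\<^sub>2 \<le> R\<close> with \<open>m r\<^sub>2 \<le> 1/2\<close>,
  the Poincare inequality on \<open>B(x, R)\<close> for the cutoff function that is \<open>1\<close> on \<open>B(x, r\<^sub>1)\<close> and \<open>0\<close> off
  \<open>B(x, r\<^sub>2)\<close> gives \<open>\<phi>\<^sub>X(m r\<^sub>1) \<le> 2 C R / (r\<^sub>2 - r\<^sub>1) * \<phi>\<^sub>Y(m r\<^sub>2)\<close>; the dilation \<open>\<sigma>\<close> plays no role because
  \<open>\<mu>(\<sigma> B) \<ge> \<mu>(B)\<close>. Since \<open>\<phi>\<^sub>X(s) \<ge> g(1/s) \<phi>\<^sub>Y(s)\<close>, a radius drop of \<open>8 C r / g(2 ^ k)\<close> from a radius with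
  \<open>m \<le> 2 ^ -k\<close> halves \<open>\<phi>\<^sub>Y(m)\<close>, hence, by concavity of \<open>\<phi>\<^sub>Y\<close>, at least halves \<open>m\<close>. The growth condition
  on \<open>g\<close> makes \<open>\<Sum>\<^sub>k 1 / g(2 ^ k)\<close> converge. So if \<open>m r \<le> 2 ^ -K\<close> with \<open>K\<close> large, the drops add up to at
  most \<open>r / 2\<close> and \<open>m (r / 2) = 0\<close>, which is impossible.\<close>

section \<open>Arc length\<close>

lemma sum_le_curve_length:
  assumes "mono_on {..n} t" "t 0 = a" "t n = b"
  shows "ennreal (\<Sum>i<n. dist (\<gamma> (t i)) (\<gamma> (t (Suc i)))) \<le> curve_length \<gamma> a b"
  unfolding curve_length_def using assms by (intro SUP_upper2[of "(n, t)"]) auto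

lemma dist_le_curve_length:
  assumes "a \<le> b"
  shows "ennreal (dist (\<gamma> a) (\<gamma> b)) \<le> curve_length \<gamma> a b"
  using sum_le_curve_length[of 1 "\<lambda>i. if i = 0 then a else b" a b \<gamma>] assms
  by (auto simp: mono_on_def)

lemma curve_length_refl: "curve_length \<gamma> a a = 0"
proof -
  have "(\<Sum>i<n. dist (\<gamma> (t i)) (\<gamma> (t (Suc i)))) = 0"
    if t: "mono_on {..n} t" "t 0 = a" "t n = a" for n :: nat and t
  proof -
    have "t i = a" if "i \<le> n" for i
    proof (rule antisym)
      show "t i \<le> a" using monotone_onD[OF t(1), of i n] t that by auto
      show "a \<le> t i" using monotone_onD[OF t(1), of 0 i] t that by auto
    qed
    then show ?thesis by (intro sum.neutral) auto
  qed
  then have "curve_length \<gamma> a a \<le> 0"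
    unfolding curve_length_def by (intro SUP_least) auto
  then show ?thesis by simp
qed

text \<open>A partition of [a, b] followed by one of [b, c] is a partition of [a, c]. The two
  suprema are then taken one after the other.\<close>

lemma curve_length_add_le:
  assumes "a \<le> b" "b \<le> c"
  shows "curve_length \<gamma> a b + curve_length \<gamma> b c \<le> curve_length \<gamma> a c"
proof -
  let ?P = "\<lambda>a b. {(n::nat, t::nat \<Rightarrow> real). mono_on {..n} t \<and> t 0 = a \<and> t n = b}"
  let ?S = "\<lambda>(n::nat, t::nat \<Rightarrow> real). ennreal (\<Sum>i<n. dist (\<gamma> (t i)) (\<gamma> (t (Suc i))))"
  \<comment> \<open>Moving a summand into a supremum fails over an empty index set, where the
    supremum is 0; the two-point partition excludes this.\<close>
  have ne: "?P u v \<noteq> {}" if "u \<le> v" for u v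
  proof -
    have "(1, \<lambda>i. if i = 0 then u else v) \<in> ?P u v" using that by (auto simp: mono_on_def)
    then show ?thesis by blast
  qed
  have "?S (n, t) + ?S (m, u) \<le> curve_length \<gamma> a c"
    if t: "mono_on {..n} t" "t 0 = a" "t n = b" and u: "mono_on {..m} u" "u 0 = b" "u m = c"
    for n m t u
  proof -
    define w where "w i = (if i \<le> n then t i else u (i - n))" for i
    have w_add: "w (n + i) = u i" for i
      using t u by (auto simp: w_def)
    have "(\<Sum>i<n+m. dist (\<gamma> (w i)) (\<gamma> (w (Suc i))))
        = (\<Sum>i<n. dist (\<gamma> (w i)) (\<gamma> (w (Suc i)))) + (\<Sum>i<m. dist (\<gamma> (w (n + i))) (\<gamma> (w (n + Suc i))))"
      by (induction m) (auto simp: add.assoc)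
    also have "(\<Sum>i<n. dist (\<gamma> (w i)) (\<gamma> (w (Suc i)))) = (\<Sum>i<n. dist (\<gamma> (t i)) (\<gamma> (t (Suc i))))"
      by (intro sum.cong) (auto simp: w_def)
    finally have eq: "(\<Sum>i<n+m. dist (\<gamma> (w i)) (\<gamma> (w (Suc i))))
        = (\<Sum>i<n. dist (\<gamma> (t i)) (\<gamma> (t (Suc i)))) + (\<Sum>i<m. dist (\<gamma> (u i)) (\<gamma> (u (Suc i))))"
      by (simp only: w_add)
    have "mono_on {..n+m} w"
    proof (rule mono_onI)
      fix i j assume ij: "i \<in> {..n+m}" "j \<in> {..n+m}" "i \<le> j"
      consider "j \<le> n" | "i \<le> n" "n < j" | "n < i" by linarith
      then show "w i \<le> w j"
      proof cases
        case 1
        then show ?thesis using ij monotone_onD[OF t(1), of i j] by (auto simp: w_def)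
      next
        case 2
        then have "t i \<le> b" using monotone_onD[OF t(1), of i n] t by auto
        also have "b \<le> u (j - n)" using monotone_onD[OF u(1), of 0 "j - n"] u 2 ij by auto
        finally show ?thesis using 2 by (simp add: w_def)
      next
        case 3
        then show ?thesis using ij monotone_onD[OF u(1), of "i - n" "j - n"] by (auto simp: w_def)
      qed
    qed
    moreover have "w 0 = a" "w (n + m) = c" using t u w_add by (auto simp: w_def)
    ultimately have "ennreal (\<Sum>i<n+m. dist (\<gamma> (w i)) (\<gamma> (w (Suc i)))) \<le> curve_length \<gamma> a c"
      by (rule sum_le_curve_length)
    then show ?thesis unfolding eq by (simp add: sum_nonneg ennreal_plus)
  qed
  then have "?S p + ?S q \<le> curve_length \<gamma> a c" if "p \<in> ?P a b" "q \<in> ?P b c" for p q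
    using that by fastforce
  then have "?S p + curve_length \<gamma> b c \<le> curve_length \<gamma> a c" if "p \<in> ?P a b" for p
    unfolding curve_length_def[of \<gamma> b c] ennreal_SUP_add_right[OF ne[OF assms(2)]]
    using that by (intro SUP_least)
  then show ?thesis
    unfolding curve_length_def[of \<gamma> a b] ennreal_SUP_add_left[OF ne[OF assms(1)], symmetric]
    by (intro SUP_least)
qed

text \<open>A partition can be cut at \<open>b\<close> without locating \<open>b\<close> in it: the
  points \<open>min (t i) b\<close> and \<open>max (t i) b\<close> partition the two halves. Only an
  interval straddling \<open>b\<close> needs the triangle inequality; elsewhere one of the two
  distances vanishes.\<close>

lemma curve_length_le_add:
  assumes "a \<le> b" "b \<le> c"
  shows "curve_length \<gamma> a c \<le> curve_length \<gamma> a b + curve_length \<gamma> b c"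
proof -
  have "ennreal (\<Sum>i<n. dist (\<gamma> (t i)) (\<gamma> (t (Suc i)))) \<le> curve_length \<gamma> a b + curve_length \<gamma> b c"
    if t: "mono_on {..n} t" "t 0 = a" "t n = c" for n :: nat and t
  proof -
    let ?S = "\<lambda>u::nat \<Rightarrow> real. \<Sum>i<n. dist (\<gamma> (u i)) (\<gamma> (u (Suc i)))"
    let ?u = "\<lambda>i. min (t i) b" and ?v = "\<lambda>i. max (t i) b"
    have "dist (\<gamma> (t i)) (\<gamma> (t (Suc i)))
        \<le> dist (\<gamma> (?u i)) (\<gamma> (?u (Suc i))) + dist (\<gamma> (?v i)) (\<gamma> (?v (Suc i)))" if "i < n" for i
      using monotone_onD[OF t(1), of i "Suc i"] that
        dist_triangle[of "\<gamma> (t i)" "\<gamma> (t (Suc i))" "\<gamma> b"]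
      by (auto simp: min_def max_def)
    then have "?S t \<le> ?S ?u + ?S ?v"
      unfolding sum.distrib[symmetric] by (intro sum_mono) auto
    then have "ennreal (?S t) \<le> ennreal (?S ?u) + ennreal (?S ?v)"
      by (simp add: sum_nonneg flip: ennreal_plus)
    also have "\<dots> \<le> curve_length \<gamma> a b + curve_length \<gamma> b c"
    proof (intro add_mono sum_le_curve_length)
      show "mono_on {..n} ?u" "mono_on {..n} ?v"
        using t(1) by (fastforce simp: mono_on_def intro: min.mono max.mono)+
    qed (use t assms in auto)
    finally show ?thesis .
  qed
  then show ?thesis
    unfolding curve_length_def[of \<gamma> a c] by (intro SUP_least) auto
qed

lemma curve_length_add:
  assumes "a \<le> b" "b \<le> c"
  shows "curve_length \<gamma> a c = curve_length \<gamma> a b + curve_length \<gamma> b c"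
  using assms by (intro antisym curve_length_le_add curve_length_add_le)

text \<open>The partitions of \<open>[a, b]\<close> are transported to \<open>[A v, B v]\<close> by the affine map.\<close>

lemma curve_length_lower_semicontinuous:
  assumes \<gamma>: "path \<gamma>" and ab: "0 \<le> a" "a < b" "b \<le> 1" and y: "y < curve_length \<gamma> a b"
    and A: "(A \<longlongrightarrow> a) F" and B: "(B \<longlongrightarrow> b) F"
    and AB: "eventually (\<lambda>v. 0 \<le> A v \<and> A v \<le> B v \<and> B v \<le> 1) F"
  shows "eventually (\<lambda>v. y < curve_length \<gamma> (A v) (B v)) F"
proof -
  obtain n t where t: "mono_on {..n} t" "t 0 = a" "t n = b"
    and less: "y < ennreal (\<Sum>i<n. dist (\<gamma> (t i)) (\<gamma> (t (Suc i))))"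
    using y unfolding curve_length_def less_SUP_iff by auto
  define c where "c i = (t i - a) / (b - a)" for i
  define u where "u v i = A v + (B v - A v) * c i" for v i
  have tr: "a \<le> t i \<and> t i \<le> b" if "i \<le> n" for i
    using monotone_onD[OF t(1), of 0 i] monotone_onD[OF t(1), of i n] t that by auto
  have c: "0 \<le> c i" "c i \<le> 1" if "i \<le> n" for i
    using tr[OF that] ab by (auto simp: c_def field_simps)
  have t_eq: "t i = a + (b - a) * c i" for i
    using ab by (simp add: c_def field_simps)
  have u_range: "u v i \<in> {0..1}" if "0 \<le> A v \<and> A v \<le> B v \<and> B v \<le> 1" "i \<le> n" for v i
  proof -
    have "0 \<le> (B v - A v) * c i" "(B v - A v) * c i \<le> B v - A v"
      using that c[of i] by (auto intro!: mult_left_le mult_nonneg_nonneg)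
    then show ?thesis using that by (auto simp: u_def)
  qed
  have lim: "((\<lambda>v. \<gamma> (u v i)) \<longlongrightarrow> \<gamma> (t i)) F" if "i \<le> n" for i
  proof (rule continuous_on_tendsto_compose[of "{0..1}" \<gamma>])
    show "continuous_on {0..1} \<gamma>" using \<gamma> by (simp add: path_def)
    show "((\<lambda>v. u v i) \<longlongrightarrow> t i) F"
      unfolding u_def t_eq by (intro tendsto_intros A B)
    show "t i \<in> {0..1}" using tr[OF that] ab by auto
    show "eventually (\<lambda>v. u v i \<in> {0..1}) F"
      using AB by eventually_elim (use u_range that in blast)
  qed
  have "((\<lambda>v. ennreal (\<Sum>i<n. dist (\<gamma> (u v i)) (\<gamma> (u v (Suc i))))) \<longlongrightarrow>
      ennreal (\<Sum>i<n. dist (\<gamma> (t i)) (\<gamma> (t (Suc i))))) F"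
    by (intro tendsto_ennrealI tendsto_sum tendsto_dist lim) auto
  then have "eventually (\<lambda>v. y < ennreal (\<Sum>i<n. dist (\<gamma> (u v i)) (\<gamma> (u v (Suc i))))) F"
    using less by (rule order_tendstoD)
  then show ?thesis
    using AB
  proof eventually_elim
    case (elim v)
    have "mono_on {..n} (u v)"
    proof (rule mono_onI)
      fix i j assume "i \<in> {..n}" "j \<in> {..n}" "i \<le> j"
      then have "c i \<le> c j"
        using monotone_onD[OF t(1), of i j] ab by (auto simp: c_def intro!: divide_right_mono)
      then show "u v i \<le> u v j" using elim by (auto simp: u_def intro!: mult_left_mono)
    qed
    moreover have "u v 0 = A v" "u v n = B v" using ab t by (auto simp: u_def c_def)
    ultimately have "ennreal (\<Sum>i<n. dist (\<gamma> (u v i)) (\<gamma> (u v (Suc i)))) \<le> curve_length \<gamma> (A v) (B v)"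
      by (rule sum_le_curve_length)
    with elim show ?case by simp
  qed
qed

lemma curve_length_finite:
  assumes "rectifiable_curve \<gamma>" "0 \<le> a" "a \<le> b" "b \<le> 1"
  shows "curve_length \<gamma> a b < top"
proof -
  have "curve_length \<gamma> 0 1 = curve_length \<gamma> 0 a + (curve_length \<gamma> a b + curve_length \<gamma> b 1)"
    using assms by (simp flip: curve_length_add)
  moreover have "curve_length \<gamma> 0 1 < top"
    using assms by (simp add: rectifiable_curve_def)
  ultimately show ?thesis by (metis ennreal_add_less_top)
qed

text \<open>Both \<open>u \<mapsto> curve_length \<gamma> 0 u\<close> and \<open>u \<mapsto> curve_length \<gamma> u 1\<close> are lower semicontinuous, and their sum is
  constant.\<close>

lemma continuous_on_arc_length:
  assumes \<gamma>: "rectifiable_curve \<gamma>"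
  shows "continuous_on {0..1} (\<lambda>u. enn2real (curve_length \<gamma> 0 u))"
proof -
  define l where "l u = enn2real (curve_length \<gamma> 0 u)" for u
  define T where "T u = enn2real (curve_length \<gamma> u 1)" for u
  have path: "path \<gamma>" using \<gamma> by (simp add: rectifiable_curve_def)
  have l: "curve_length \<gamma> 0 u = ennreal (l u)" if "u \<in> {0..1}" for u
    using curve_length_finite[OF \<gamma>, of 0 u] that by (simp add: l_def)
  have T: "curve_length \<gamma> u 1 = ennreal (T u)" if "u \<in> {0..1}" for u
    using curve_length_finite[OF \<gamma>, of u 1] that by (simp add: T_def)
  have nonneg: "0 \<le> l u" "0 \<le> T u" for u by (auto simp: l_def T_def)
  have sum: "l u + T u = l 1" if "u \<in> {0..1}" for u
  proof -
    have "ennreal (l 1) = ennreal (l u) + ennreal (T u)"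
      using curve_length_add[of 0 u 1 \<gamma>] l[of 1] l[of u] T[of u] that by simp
    then show ?thesis using nonneg by (simp flip: ennreal_plus)
  qed
  have ev: "eventually (\<lambda>v. v \<in> {0..1}) (at u within {0..1})" for u :: real
    by (simp add: eventually_at_filter)
  have lim: "(l \<longlongrightarrow> l u) (at u within {0..1})" if u: "u \<in> {0..1}" for u
  proof (rule order_tendstoI)
    fix y assume y: "y < l u"
    show "eventually (\<lambda>v. y < l v) (at u within {0..1})"
    \<comment> \<open>Negative \<open>y\<close> is split off because \<open>ennreal\<close>
      truncates it to 0. For the rest, \<open>u \<noteq> 0\<close> provides the nondegenerate
      interval that semicontinuity needs.\<close>
    proof (cases "y < 0")
      case True
      then show ?thesis by (simp add: less_le_trans[OF _ nonneg(1)])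
    next
      case False
      with y have "u \<noteq> 0" by (auto simp: l_def curve_length_refl)
      with False y u have "eventually (\<lambda>v. ennreal y < curve_length \<gamma> 0 v) (at u within {0..1})"
        using ev[of u]
        by (intro curve_length_lower_semicontinuous[OF path, of 0 u])
           (auto simp: l ennreal_less_iff elim!: eventually_mono intro: tendsto_ident_at)
      then show ?thesis using ev[of u] by eventually_elim (use False in \<open>simp add: l ennreal_less_iff\<close>)
    qed
  next
    fix y assume y: "l u < y"
    show "eventually (\<lambda>v. l v < y) (at u within {0..1})"
    proof (cases "l 1 < y")
      case True
      then have "l v < y" if "v \<in> {0..1}" for v using sum[OF that] nonneg(2)[of v] by linarith
      then show ?thesis using ev[of u] by (auto elim: eventually_mono)
    next
      case False
      with y have "u \<noteq> 1" by auto
      have "l 1 - y < T u" using sum[OF u] y by linarith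
      then have "eventually (\<lambda>v. ennreal (l 1 - y) < curve_length \<gamma> v 1) (at u within {0..1})"
        using ev[of u] u \<open>u \<noteq> 1\<close> False
        by (intro curve_length_lower_semicontinuous[OF path, of u 1])
           (auto simp: T ennreal_less_iff elim!: eventually_mono intro: tendsto_ident_at)
      then show ?thesis using ev[of u]
      proof eventually_elim
        case (elim v)
        then have "l 1 - y < T v" using False by (simp add: T ennreal_less_iff)
        then show ?case using sum[of v] elim by simp
      qed
    qed
  qed
  then show ?thesis unfolding continuous_on_def l_def by blast
qed

text \<open>A chord is at most the length between its ends, and that length is a difference of arc
  length parameters. The estimate is proved for arbitrary preimages of \<open>s\<close> and
  \<open>s'\<close>, so the choice made in \<open>arc_length_param\<close> is harmless.\<close>

lemma arc_length_param_Lipschitz_endpoints: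
  assumes \<gamma>: "rectifiable_curve \<gamma>"
  defines "L \<equiv> enn2real (curve_length \<gamma> 0 1)"
  shows "\<And>s s'. 0 \<le> s \<Longrightarrow> s \<le> s' \<Longrightarrow> s' \<le> L \<Longrightarrow>
      dist (arc_length_param \<gamma> s) (arc_length_param \<gamma> s') \<le> s' - s"
    and "arc_length_param \<gamma> 0 = \<gamma> 0" and "arc_length_param \<gamma> L = \<gamma> 1"
proof -
  define U where "U s = (SOME u. u \<in> {0..1} \<and> curve_length \<gamma> 0 u = ennreal s)" for s
  have fin: "curve_length \<gamma> 0 u = ennreal (enn2real (curve_length \<gamma> 0 u))" if "u \<in> {0..1}" for u
    using curve_length_finite[OF \<gamma>, of 0 u] that by simp
  have U: "U s \<in> {0..1} \<and> curve_length \<gamma> 0 (U s) = ennreal s" if "0 \<le> s" "s \<le> L" for s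
  proof -
    have "\<exists>u\<ge>0. u \<le> 1 \<and> enn2real (curve_length \<gamma> 0 u) = s"
      using that continuous_on_arc_length[OF \<gamma>]
      by (intro IVT') (auto simp: curve_length_refl L_def)
    then obtain u where "u \<in> {0..1}" "enn2real (curve_length \<gamma> 0 u) = s" by auto
    then have "u \<in> {0..1} \<and> curve_length \<gamma> 0 u = ennreal s" using fin by metis
    then show ?thesis unfolding U_def by (rule someI)
  qed
  have dist_le: "dist (\<gamma> u) (\<gamma> v) \<le> s' - s"
    if uv: "u \<in> {0..1}" "v \<in> {0..1}" "u \<le> v" and eq: "curve_length \<gamma> 0 u = ennreal s"
      "curve_length \<gamma> 0 v = ennreal s'" and "0 \<le> s" "0 \<le> s'" for u v s s'
  proof -
    have "ennreal s + ennreal (dist (\<gamma> u) (\<gamma> v)) \<le> ennreal s'"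
      using curve_length_add[of 0 u v \<gamma>] dist_le_curve_length[of u v \<gamma>] uv eq
      by (metis add_left_mono atLeastAtMost_iff)
    then have "ennreal (s + dist (\<gamma> u) (\<gamma> v)) \<le> ennreal s'" using \<open>0 \<le> s\<close> by simp
    then show ?thesis using \<open>0 \<le> s'\<close> by simp
  qed
  have any: "dist (\<gamma> u) (\<gamma> v) \<le> s' - s"
    if uv: "u \<in> {0..1}" "v \<in> {0..1}" and eq: "curve_length \<gamma> 0 u = ennreal s"
      "curve_length \<gamma> 0 v = ennreal s'" and s: "0 \<le> s" "s \<le> s'" for u v s s'
  proof (cases "u \<le> v")
    case True
    then show ?thesis using dist_le[of u v s s'] uv eq s by auto
  next
    \<comment> \<open>Preimages in reversed order force \<open>s = s'\<close>: a distance is bounded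
      by \<open>s - s'\<close>, which is at most 0.\<close>
    case False
    then have "dist (\<gamma> v) (\<gamma> u) \<le> s - s'" using dist_le[of v u s' s] uv eq s by auto
    with s show ?thesis using zero_le_dist[of "\<gamma> v" "\<gamma> u"] by (simp add: dist_commute)
  qed
  have L: "0 \<le> L" by (simp add: L_def)
  have p: "arc_length_param \<gamma> s = \<gamma> (U s)" for s by (simp add: arc_length_param_def U_def)
  show "dist (arc_length_param \<gamma> s) (arc_length_param \<gamma> s') \<le> s' - s" if "0 \<le> s" "s \<le> s'" "s' \<le> L" for s s'
    unfolding p using that U[of s] U[of s'] by (intro any) auto
  \<comment> \<open>For equal parameters the bound in \<open>any\<close> is 0, so the chosen
    preimage gives the same point as the endpoint.\<close>
  have "dist (\<gamma> 0) (\<gamma> (U 0)) \<le> 0 - 0"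
    using U[of 0] L by (intro any) (auto simp: curve_length_refl)
  then show "arc_length_param \<gamma> 0 = \<gamma> 0" by (simp add: p)
  have "dist (\<gamma> 1) (\<gamma> (U L)) \<le> L - L"
    using U[of L] L fin[of 1] by (intro any) (auto simp: L_def)
  then show "arc_length_param \<gamma> L = \<gamma> 1" by (simp add: p)
qed

section \<open>Cutoff functions\<close>

definition cutoff :: "'a::metric_space \<Rightarrow> real \<Rightarrow> real \<Rightarrow> 'a \<Rightarrow> real" where
  "cutoff x r\<^sub>1 r\<^sub>2 y = max 0 (min 1 ((r\<^sub>2 - dist x y) / (r\<^sub>2 - r\<^sub>1)))"

lemma cutoff_Lipschitz:
  assumes "r\<^sub>1 < r\<^sub>2"
  shows "cutoff x r\<^sub>1 r\<^sub>2 y - cutoff x r\<^sub>1 r\<^sub>2 z \<le> dist y z / (r\<^sub>2 - r\<^sub>1)"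
proof -
  have "(r\<^sub>2 - dist x y) / (r\<^sub>2 - r\<^sub>1) - (r\<^sub>2 - dist x z) / (r\<^sub>2 - r\<^sub>1) \<le> dist y z / (r\<^sub>2 - r\<^sub>1)"
    using dist_triangle[of x z y] assms unfolding diff_divide_distrib[symmetric]
    by (intro divide_right_mono) auto
  moreover have "0 \<le> dist y z / (r\<^sub>2 - r\<^sub>1)" using assms by simp
  ultimately show ?thesis unfolding cutoff_def by linarith
qed

text \<open>Along the arc length parametrization the cutoff is Lipschitz with constant 1/d, where
  \<open>d = r\<^sub>2 - r\<^sub>1\<close>. Counted from the end where it is larger, it stays
  positive on a stretch long enough to pay for the whole difference, and positivity keeps the curve
  in \<open>ball x r\<^sub>2\<close>, where the gradient equals 1/d.\<close>

lemma upper_gradient_cutoff: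
  fixes x :: "'a::metric_space"
  assumes r: "r\<^sub>1 < r\<^sub>2"
  shows "upper_gradient (cutoff x r\<^sub>1 r\<^sub>2) (\<lambda>y. ennreal (1 / (r\<^sub>2 - r\<^sub>1)) * indicator (ball x r\<^sub>2) y)"
    (is "upper_gradient ?f ?\<rho>")
  unfolding upper_gradient_def
proof (intro conjI allI impI)
  show "?\<rho> \<in> borel_measurable borel"
    by (intro borel_measurable_times_ennreal borel_measurable_const borel_measurable_indicator
        borel_open open_ball)
  fix p q :: 'a and \<gamma> assume "rectifiable_curve \<gamma> \<and> pathstart \<gamma> = p \<and> pathfinish \<gamma> = q"
  then have \<gamma>: "rectifiable_curve \<gamma>" and pq: "\<gamma> 0 = p" "\<gamma> 1 = q"
    by (auto simp: pathstart_def pathfinish_def)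
  define L where "L = enn2real (curve_length \<gamma> 0 1)"
  define h where "h s = ?f (arc_length_param \<gamma> s)" for s
  define d where "d = r\<^sub>2 - r\<^sub>1"
  have d: "d > 0" using r by (simp add: d_def)
  note arc = arc_length_param_Lipschitz_endpoints[OF \<gamma>, folded L_def]
  have L: "0 \<le> L" by (simp add: L_def)
  have lip: "h s - h s' \<le> \<bar>s - s'\<bar> / d" if "s \<in> {0..L}" "s' \<in> {0..L}" for s s'
  proof -
    have "dist (arc_length_param \<gamma> s) (arc_length_param \<gamma> s') \<le> \<bar>s - s'\<bar>"
      using arc(1)[of s s'] arc(1)[of s' s] that
      by (cases "s \<le> s'") (auto simp: dist_commute)
    then have "dist (arc_length_param \<gamma> s) (arc_length_param \<gamma> s') / d \<le> \<bar>s - s'\<bar> / d"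
      using d by (simp add: divide_right_mono)
    then show ?thesis using cutoff_Lipschitz[OF r] unfolding h_def d_def by (rule order_trans[rotated])
  qed
  have in_ball: "arc_length_param \<gamma> s \<in> ball x r\<^sub>2" if "h s > 0" for s
    using that d by (auto simp: h_def cutoff_def d_def zero_less_divide_iff less_max_iff_disj)
  have bound: "ennreal ((b - a) / d) \<le> curve_integral \<gamma> ?\<rho>"
    if "a \<le> b" "{a<..<b} \<subseteq> {0..L}" "\<And>s. s \<in> {a<..<b} \<Longrightarrow> h s > 0" for a b
  proof -
    have "ennreal ((b - a) / d) = (\<integral>\<^sup>+s. ennreal (1 / d) * indicator {a<..<b} s \<partial>lborel)"
      using that d by (simp add: nn_integral_cmult divide_inverse mult.commute flip: ennreal_mult'')
    also have "\<dots> \<le> curve_integral \<gamma> ?\<rho>"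
      unfolding curve_integral_def L_def[symmetric]
      by (intro nn_integral_mono) (use that in_ball in \<open>auto simp: indicator_def d_def\<close>)
    finally show ?thesis .
  qed
  have h01: "0 \<le> h s" for s by (simp add: h_def cutoff_def)
  have ends: "?f p = h 0" "?f q = h L" using arc(2,3) pq by (auto simp: h_def)
  show "ennreal \<bar>?f p - ?f q\<bar> \<le> curve_integral \<gamma> ?\<rho>"
  proof (cases "h L \<le> h 0")
    case True
    \<comment> \<open>\<open>h\<close> cannot vanish before arc length \<open>d * h 0\<close>. On a
      shorter curve the Lipschitz bound over the whole length suffices; otherwise
      \<open>b / d = h 0\<close> already dominates the drop, because
      \<open>0 \<le> h L\<close>.\<close>
    define b where "b = min L (d * h 0)"
    have "h s > 0" if "s \<in> {0<..<b}" for s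
    proof -
      have "h 0 - h s \<le> s / d" using lip[of 0 s] that L by (auto simp: b_def)
      also have "s / d < h 0" using that d by (simp add: b_def field_simps)
      finally show ?thesis by simp
    qed
    then have "ennreal ((b - 0) / d) \<le> curve_integral \<gamma> ?\<rho>"
      using d L h01 by (intro bound) (auto simp: b_def)
    moreover have "h 0 - h L \<le> (b - 0) / d"
      using lip[of 0 L] L d h01[of L] by (auto simp: b_def min_def)
    ultimately show ?thesis using True unfolding ends
      by (simp add: order_trans[OF ennreal_leI])
  next
    case False
    \<comment> \<open>Mirror image of the other case, counting back from the end of the
      curve.\<close>
    define a where "a = max 0 (L - d * h L)"
    have "h s > 0" if "s \<in> {a<..<L}" for s
    proof -
      have "h L - h s \<le> (L - s) / d" using lip[of L s] that L by (auto simp: a_def)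
      also have "(L - s) / d < h L" using that d by (simp add: a_def field_simps)
      finally show ?thesis by simp
    qed
    then have "ennreal ((L - a) / d) \<le> curve_integral \<gamma> ?\<rho>"
      using d L h01 by (intro bound) (auto simp: a_def)
    moreover have "h L - h 0 \<le> (L - a) / d"
      using lip[of L 0] L d h01[of 0] by (auto simp: a_def max_def)
    ultimately show ?thesis using False unfolding ends
      by (simp add: order_trans[OF ennreal_leI])
  qed
qed

section \<open>Fundamental functions and localized norms\<close>

lemma banach_function_norm_mono:
  assumes "banach_function_norm M N" "f \<in> borel_measurable M" "g \<in> borel_measurable M"
    and "\<And>x. x \<in> space M \<Longrightarrow> g x \<le> f x"
  shows "N g \<le> N f"
  using assms unfolding banach_function_norm_def by (auto intro: AE_I2)

lemma banach_function_norm_cmult: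
  assumes "banach_function_norm M N" "f \<in> borel_measurable M" "0 \<le> a"
  shows "N (\<lambda>x. ennreal a * f x) = ennreal a * N f"
  using assms unfolding banach_function_norm_def by blast

lemma borel_measurable_lebesgue_interval:
  "f \<in> borel_measurable borel \<Longrightarrow> f \<in> borel_measurable (lebesgue_interval M)"
  unfolding lebesgue_interval_def by (intro measurable_restrict_space1) simp

lemma space_lebesgue_interval:
  "space (lebesgue_interval M) = {s. 0 < s \<and> ennreal s < emeasure M (space M)}"
  by (simp add: lebesgue_interval_def space_restrict_space)

text \<open>The norm is finite, so \<open>enn2real\<close> loses nothing. The norm only sees the
  part of the interval inside the underlying space, which covers \<open>s\<close> beyond the total
  mass.\<close>

lemma norm_indicator_eq_fundamental_function:
  assumes "banach_function_norm (lebesgue_interval M) Nbar"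
  shows "Nbar (indicator {0<..<s}) = ennreal (fundamental_function Nbar s)"
proof -
  let ?L = "lebesgue_interval M"
  let ?E = "{0<..<s} \<inter> space ?L"
  have meas: "{s. 0 < s \<and> ennreal s < emeasure M (space M)} \<in> sets borel"
    by measurable
  then have E: "?E \<in> sets ?L"
    by (auto simp: lebesgue_interval_def sets_restrict_space space_restrict_space)
  have "emeasure ?L ?E = emeasure lborel ?E"
    unfolding lebesgue_interval_def using meas
    by (intro emeasure_restrict_space) (auto simp: space_restrict_space)
  also have "\<dots> \<le> emeasure lborel {0<..<s}"
    by (intro emeasure_mono) auto
  also have "\<dots> < \<infinity>"
    by (cases "0 \<le> s") auto
  finally have fin: "Nbar (indicator ?E) < \<infinity>"
    using assms E unfolding banach_function_norm_def by blast
  have "Nbar (indicator {0<..<s}) \<le> Nbar (indicator ?E)"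
    using E by (intro banach_function_norm_mono[OF assms] borel_measurable_indicator
        borel_measurable_lebesgue_interval) (auto simp: indicator_def)
  with fin show ?thesis by (simp add: fundamental_function_def)
qed

text \<open>Only points below the total mass are compared. Besides monotonicity this gives the
  inequality for every \<open>s\<close> as soon as \<open>t\<close> is at least the total
  mass.\<close>

lemma fundamental_function_mono:
  assumes B: "banach_function_norm (lebesgue_interval M) Nbar"
    and "\<And>u. ennreal u < emeasure M (space M) \<Longrightarrow> u < s \<Longrightarrow> u < t"
  shows "fundamental_function Nbar s \<le> fundamental_function Nbar t"
proof -
  have "Nbar (indicator {0<..<s}) \<le> Nbar (indicator {0<..<t})"
    using assms(2)
    by (intro banach_function_norm_mono[OF B] borel_measurable_indicator
        borel_measurable_lebesgue_interval)
       (auto simp: indicator_def space_lebesgue_interval)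
  then show ?thesis
    unfolding norm_indicator_eq_fundamental_function[OF B]
    by (simp add: fundamental_function_def)
qed

text \<open>Concavity is only available on \<open>[0, \<mu>(\<Omega>)]\<close>; beyond \<open>\<mu>(\<Omega>)\<close> the fundamental function is constant.\<close>

lemma fundamental_function_quasi_concave:
  assumes B: "banach_function_norm (lebesgue_interval M) Nbar"
    and N: "normalized_fundamental M Nbar" and ab: "0 < a" "a \<le> b"
  shows "a * fundamental_function Nbar b \<le> b * fundamental_function Nbar a"
proof -
  let ?\<phi> = "fundamental_function Nbar" and ?m = "emeasure M (space M)"
  have nonneg: "0 \<le> ?\<phi> s" for s by (simp add: fundamental_function_def)
  have conc: "a * ?\<phi> c \<le> c * ?\<phi> a" if c: "a \<le> c" "ennreal c \<le> ?m" for c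
  proof -
    have "concave_on {s. 0 \<le> s \<and> ennreal s \<le> ?m} ?\<phi>" "?\<phi> 0 = 0"
      using N by (auto simp: normalized_fundamental_def)
    \<comment> \<open>\<open>a\<close> lies at the fraction \<open>a / c\<close> of the way from 0
      to \<open>c\<close>, and the value at 0 is 0.\<close>
    from concave_onD[OF this(1), of "a / c" 0 c] this(2) have "a / c * ?\<phi> c \<le> ?\<phi> a"
      using c ab by (simp add: divide_le_eq)
    then show ?thesis using c ab by (simp add: field_simps)
  qed
  show ?thesis
  proof (cases "ennreal b \<le> ?m")
    case True
    then show ?thesis using conc ab by blast
  next
    case False
    then have "?m < top" by (metis not_le order.strict_trans2 top_greatest)
    then obtain c where c: "0 \<le> c" "?m = ennreal c"
      by (metis ennreal_cases less_irrefl top.not_eq_extremum)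
    have less_c: "u < c" if "ennreal u < ?m" for u
      using that c ennreal_leI[of c u] by (auto simp: not_le[symmetric])
    have "c < b" using False c ab by (simp add: not_le ennreal_less_iff)
    \<comment> \<open>Here \<open>c\<close> is the total mass and \<open>b\<close> lies beyond it.
      The value at \<open>b\<close> is compared with the one at \<open>c\<close>, or with the one at
      \<open>a\<close> if \<open>a\<close> is beyond the mass too.\<close>
    show ?thesis
    proof (cases "a \<le> c")
      case True
      have "?\<phi> b \<le> ?\<phi> c"
        using less_c by (intro fundamental_function_mono[OF B])
      then have "a * ?\<phi> b \<le> a * ?\<phi> c" using ab by simp
      also have "\<dots> \<le> c * ?\<phi> a" using conc[of c] True c by simp
      also have "\<dots> \<le> b * ?\<phi> a" using \<open>c < b\<close> nonneg by (intro mult_right_mono) auto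
      finally show ?thesis .
    next
      case False
      have "?\<phi> b \<le> ?\<phi> a"
        using less_c False by (intro fundamental_function_mono[OF B]) fastforce
      then show ?thesis using ab nonneg by (intro mult_mono) auto
    qed
  qed
qed

section \<open>Rearrangements and two-sided bounds for localized norms\<close>

lemma rearrangement_antimono: "s \<le> t \<Longrightarrow> rearrangement M f t \<le> rearrangement M f s"
  unfolding rearrangement_def by (intro Inf_superset_mono) (auto intro: order_trans ennreal_leI)

text \<open>The superlevel sets of a monotone function on the line are intervals.\<close>

lemma borel_measurable_antimono_ennreal:
  fixes f :: "real \<Rightarrow> ennreal"
  assumes "antimono f"
  shows "f \<in> borel_measurable borel"
proof (rule borel_measurableI_greater)
  fix y
  have "is_interval {x. y < f x}"
    unfolding is_interval_1 using antimonoD[OF assms] by (auto intro: less_le_trans)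
  then show "{x \<in> space borel. y < f x} \<in> sets borel"
    by (simp add: real_interval_borel_measurable)
qed

lemma borel_measurable_ball_norm_integrand:
  assumes "0 \<le> m"
  shows "(\<lambda>s. indicator {0<..<1} s * rearrangement M h (s * m)) \<in> borel_measurable (lebesgue_interval N)"
  using assms
  by (intro borel_measurable_lebesgue_interval borel_measurable_times_ennreal
      borel_measurable_indicator borel_measurable_antimono_ennreal)
     (auto simp: antimono_def intro!: rearrangement_antimono mult_right_mono)

text \<open>Since \<open>h\<close> is at least \<open>c\<close> on \<open>E\<close>, its
  rearrangement is at least \<open>c\<close> up to \<open>measure M E\<close>; the rescaling by
  \<open>measure M B\<close> turns this into an interval of length
  \<open>measure M E / measure M B\<close>.\<close>

lemma ball_norm_ge:
  assumes N: "banach_function_norm (lebesgue_interval M) Nbar"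
    and h: "h \<in> borel_measurable M" and B: "B \<in> sets M" "emeasure M B < \<infinity>" "0 < measure M B"
    and E: "E \<in> sets M" "E \<subseteq> B" and c: "0 \<le> c" "\<And>y. y \<in> E \<Longrightarrow> ennreal c \<le> h y"
  shows "ennreal (c * fundamental_function Nbar (measure M E / measure M B)) \<le> ball_norm M Nbar B h"
proof -
  let ?m = "measure M E / measure M B"
  have fin: "emeasure M E < \<infinity>"
    using emeasure_mono[OF E(2) B(1)] B(2) by simp
  then have EE: "emeasure M E = ennreal (measure M E)"
    by (simp add: emeasure_eq_ennreal_measure less_top)
  have "measure M E \<le> measure M B"
    using E B by (intro measure_mono_fmeasurable) (auto simp: fmeasurable_def)
  then have m1: "?m \<le> 1" using B by simp
  have "ennreal (c * fundamental_function Nbar ?m) = Nbar (\<lambda>s. ennreal c * indicator {0<..<?m} s)"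
    using c(1) by (subst banach_function_norm_cmult[OF N])
      (auto intro!: borel_measurable_lebesgue_interval
        simp: norm_indicator_eq_fundamental_function[OF N] ennreal_mult')
  also have "\<dots> \<le> ball_norm M Nbar B h"
    unfolding ball_norm_def
  proof (rule banach_function_norm_mono[OF N])
    fix s
    have "ennreal c \<le> rearrangement M (\<lambda>y. h y * indicator B y) (s * measure M B)" if s: "0 < s" "s < ?m"
      unfolding rearrangement_def
    proof (rule Inf_greatest, rule ccontr)
      fix t assume t: "t \<in> {t. distribution_fun M (\<lambda>y. h y * indicator B y) t \<le> ennreal (s * measure M B)}"
        and "\<not> ennreal c \<le> t"
      then have "E \<subseteq> {x \<in> space M. t < h x * indicator B x}"
        using c(2) E sets.sets_into_space[OF E(1)] by (fastforce simp: not_le intro: less_le_trans)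
      then have "emeasure M E \<le> distribution_fun M (\<lambda>y. h y * indicator B y) t"
        unfolding distribution_fun_def
        by (intro emeasure_mono) (use h B in \<open>auto intro!: borel_measurable_less\<close>)
      also have "\<dots> \<le> ennreal (s * measure M B)" using t by simp
      finally have "measure M E \<le> s * measure M B"
        unfolding EE using s B by simp
      then show False using s B by (simp add: field_simps)
    qed
    then show "ennreal c * indicator {0<..<?m} s
        \<le> indicator {0<..<1} s * rearrangement M (\<lambda>y. h y * indicator B y) (s * measure M B)"
      using m1 by (auto simp: indicator_def)
  next
    show "(\<lambda>s. ennreal c * indicator {0<..<?m} s) \<in> borel_measurable (lebesgue_interval M)"
      by (intro borel_measurable_lebesgue_interval) simp
  qed (auto intro: borel_measurable_ball_norm_integrand)
  finally show ?thesis .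
qed

text \<open>Normalizing by a smaller \<open>m\<close> only lengthens the interval on which the
  rearrangement may be nonzero. Taking the dilated ball for \<open>B\<close> and the measure of the
  original ball for \<open>m\<close> eliminates the dilation \<open>\<sigma>\<close>.\<close>

lemma ball_norm_le:
  assumes N: "banach_function_norm (lebesgue_interval M) Nbar"
    and m: "0 < m" "m \<le> measure M B" and B: "B \<in> sets M"
    and E: "E \<in> sets M" "emeasure M E < \<infinity>" and c: "0 \<le> c"
  shows "ball_norm M Nbar B (\<lambda>y. ennreal c * indicator E y)
    \<le> ennreal (c * fundamental_function Nbar (measure M E / m))"
proof -
  let ?m = "measure M E / m"
  let ?h = "\<lambda>y. ennreal c * indicator E y * indicator B y"
  have EE: "emeasure M E = ennreal (measure M E)"
    using E by (simp add: emeasure_eq_ennreal_measure less_top)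
  have "ball_norm M Nbar B (\<lambda>y. ennreal c * indicator E y)
      \<le> Nbar (\<lambda>s. ennreal c * indicator {0<..<?m} s)"
    unfolding ball_norm_def
  proof (rule banach_function_norm_mono[OF N])
    fix s
    \<comment> \<open>The level \<open>c\<close> is never exceeded. The level 0 is exceeded at most
      on \<open>E\<close>, so it is admissible in the infimum once \<open>s\<close> reaches
      \<open>?m\<close>.\<close>
    have "rearrangement M ?h (s * measure M B) \<le> ennreal c"
      unfolding rearrangement_def
      by (rule Inf_lower) (auto simp: distribution_fun_def indicator_def)
    moreover have "rearrangement M ?h (s * measure M B) \<le> 0" if s: "0 < s" "?m \<le> s"
      unfolding rearrangement_def
    proof (rule Inf_lower, simp)
      have "distribution_fun M ?h 0 \<le> emeasure M E"
        unfolding distribution_fun_def using E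
        by (intro emeasure_mono) (auto simp: indicator_def split: if_splits)
      also have "\<dots> \<le> ennreal (s * measure M B)"
      proof -
        have "measure M E \<le> s * m" using s m by (simp add: field_simps)
        also have "\<dots> \<le> s * measure M B" using s m by (intro mult_left_mono) auto
        finally show ?thesis unfolding EE by (rule ennreal_leI)
      qed
      finally show "distribution_fun M ?h 0 \<le> ennreal (s * measure M B)" .
    qed
    ultimately show "indicator {0<..<1} s * rearrangement M ?h (s * measure M B)
        \<le> ennreal c * indicator {0<..<?m} s"
      by (cases "0 < s"; cases "s < ?m") (auto simp: indicator_def)
  next
    show "(\<lambda>s. ennreal c * indicator {0<..<?m} s) \<in> borel_measurable (lebesgue_interval M)"
      by (intro borel_measurable_lebesgue_interval) simp
  qed (auto intro: borel_measurable_ball_norm_integrand)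
  also have "\<dots> = ennreal (c * fundamental_function Nbar ?m)"
    using c by (subst banach_function_norm_cmult[OF N])
      (auto intro!: borel_measurable_lebesgue_interval
        simp: norm_indicator_eq_fundamental_function[OF N] ennreal_mult')
  finally show ?thesis .
qed

section \<open>Summability\<close>

text \<open>Cauchy condensation bounds the partial sums by a constant plus half of the same partial sums.\<close>

lemma summable_if_dyadic_le_half:
  fixes a :: "nat \<Rightarrow> real"
  assumes dec: "decseq a" and nonneg: "\<And>n. 0 \<le> a n"
    and half: "\<And>j. J \<le> j \<Longrightarrow> 2 ^ Suc j * a (2 ^ Suc j) \<le> a j / 2"
  shows "summable a"
proof -
  define S where "S n = (\<Sum>k<n. a k)" for n
  define D where "D = (\<Sum>j<J. 2 ^ Suc j * a (2 ^ Suc j))"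
  \<comment> \<open>The dyadic block from 2^n to 2^(n+1) has 2^n terms, each at most
    \<open>a (2 ^ n)\<close>.\<close>
  have cond: "S (2 ^ n) \<le> a 0 + (\<Sum>j<n. 2 ^ j * a (2 ^ j))" for n
  proof (induction n)
    case (Suc n)
    have "S (2 ^ Suc n) = S (2 ^ n) + (\<Sum>k = 2 ^ n..<2 ^ Suc n. a k)"
      unfolding S_def lessThan_atLeast0 by (rule sum.atLeastLessThan_concat[symmetric]) auto
    also have "(\<Sum>k = 2 ^ n..<2 ^ Suc n. a k) \<le> (\<Sum>k = 2 ^ n..<2 ^ Suc n :: nat. a (2 ^ n))"
      using decseqD[OF dec] by (intro sum_mono) auto
    finally show ?case using Suc by simp
  qed (simp add: S_def)
  \<comment> \<open>The finitely many indices below \<open>J\<close>, to which \<open>half\<close>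
    does not apply, are collected in the constant \<open>D\<close>.\<close>
  have "(\<Sum>j<n. 2 ^ Suc j * a (2 ^ Suc j)) \<le> D + S n / 2" for n
  proof -
    have "(\<Sum>j<n. 2 ^ Suc j * a (2 ^ Suc j))
        \<le> (\<Sum>j<n. (if j < J then 2 ^ Suc j * a (2 ^ Suc j) else 0) + a j / 2)"
      using half nonneg by (intro sum_mono) auto
    also have "\<dots> = (\<Sum>j\<in>{..<n} \<inter> {..<J}. 2 ^ Suc j * a (2 ^ Suc j)) + S n / 2"
      by (simp add: sum.distrib S_def sum_divide_distrib sum.inter_restrict del: power_Suc)
    also have "(\<Sum>j\<in>{..<n} \<inter> {..<J}. 2 ^ Suc j * a (2 ^ Suc j)) \<le> D"
      unfolding D_def using nonneg by (intro sum_mono2) auto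
    finally show ?thesis by simp
  qed
  moreover have "(\<Sum>j<Suc n. 2 ^ j * a (2 ^ j)) = a 1 + (\<Sum>j<n. 2 ^ Suc j * a (2 ^ Suc j))" for n
    by (subst sum.lessThan_Suc_shift) simp
  ultimately have "S (2 ^ Suc n) \<le> a 0 + a 1 + D + S n / 2" for n
    using cond[of "Suc n"] by (smt (verit))
  moreover have "S n \<le> S (2 ^ Suc n)" for n
  proof -
    have "n \<le> 2 ^ Suc n" by (metis less_exp less_imp_le Suc_leD)
    then show ?thesis unfolding S_def using nonneg by (intro sum_mono2) auto
  qed
  \<comment> \<open>\<open>S n\<close> is bounded by a constant plus \<open>S n / 2\<close>, and the
    half is absorbed on the left.\<close>
  ultimately have "S n \<le> 2 * (a 0 + a 1 + D)" for n
    by (smt (verit) field_sum_of_halves)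
  then show ?thesis
    using nonneg by (intro summableI_nonneg_bounded) (auto simp: S_def)
qed

text \<open>With N = 2^(j+1) and exp t = 2^N, the growth condition becomes N g(2^j) \<le> g(2^N) / 2
  for large j, which is the dyadic hypothesis for the sequence 1 / g(2^n).\<close>

lemma summable_inverse_if_superlogarithmic:
  fixes g :: "real \<Rightarrow> real"
  assumes mono: "mono_on {1..} g" and ge1: "\<And>t. 1 \<le> t \<Longrightarrow> 1 \<le> g t"
    and lim: "((\<lambda>t. t * g t / g (exp t)) \<longlongrightarrow> 0) at_top"
  shows "summable (\<lambda>n. 1 / g (2 ^ n))"
proof -
  have g_mono: "g s \<le> g t" if "1 \<le> s" "s \<le> t" for s t
    using monotone_onD[OF mono, of s t] that by simp
  \<comment> \<open>The threshold \<open>ln 2 / 2\<close> is chosen so that the factor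
    \<open>ln 2\<close> contained in \<open>t\<close> cancels and 1/2 remains.\<close>
  have "eventually (\<lambda>t. t * g t / g (exp t) < ln 2 / 2) at_top"
    using lim by (rule order_tendstoD) simp
  then obtain T where T: "\<And>t. T \<le> t \<Longrightarrow> t * g t / g (exp t) < ln 2 / 2"
    by (auto simp: eventually_at_top_linorder)
  obtain J :: nat where J: "T \<le> 2 ^ J"
    using real_arch_pow[of 2 T] by (auto intro: less_imp_le)
  have ln2: "1 / 2 \<le> ln (2::real)" using ln2_ge_two_thirds by simp
  show ?thesis
  proof (rule summable_if_dyadic_le_half[of _ J])
    show "decseq (\<lambda>n. 1 / g (2 ^ n))"
      by (intro decseq_SucI frac_le g_mono less_le_trans[OF zero_less_one ge1]) auto
    show "0 \<le> 1 / g (2 ^ n)" for n using ge1[of "2 ^ n"] by simp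
    fix j assume "J \<le> j"
    define N :: nat where "N = 2 ^ Suc j"
    define t where "t = real N * ln 2"
    \<comment> \<open>The factor 2 in \<open>N\<close> compensates for \<open>ln 2\<close>, which is
      at least 1/2; this yields \<open>g (2 ^ j) \<le> g t\<close>.\<close>
    have "2 ^ j \<le> t"
      using ln2 by (simp add: t_def N_def)
    moreover have "(2::real) ^ J \<le> 2 ^ j" using \<open>J \<le> j\<close> by simp
    moreover have "(1::real) \<le> 2 ^ j" by simp
    ultimately have t: "T \<le> t" "1 \<le> t" "2 ^ j \<le> t"
      using J by linarith+
    have ex: "exp t = 2 ^ N" by (simp add: t_def exp_of_nat_mult)
    have pos: "0 < g (2 ^ N)" "0 < g (2 ^ j)" "g (2 ^ j) \<le> g t"
      using ge1[of "2 ^ N"] ge1[of "2 ^ j"] g_mono[of "2 ^ j" t] t by auto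
    have "real N * ln 2 * g (2 ^ j) \<le> t * g t"
      unfolding t_def[symmetric] using pos t by (intro mult_left_mono) auto
    also have "\<dots> \<le> ln 2 / 2 * g (2 ^ N)"
      using T[OF t(1)] pos by (simp add: ex field_simps)
    finally have "ln 2 * (real N * g (2 ^ j)) \<le> ln 2 * (g (2 ^ N) / 2)"
      by (simp add: algebra_simps)
    then have "real N * g (2 ^ j) \<le> g (2 ^ N) / 2"
      by (subst (asm) mult_le_cancel_left_pos) auto
    then have "real N * (1 / g (2 ^ N)) \<le> 1 / g (2 ^ j) / 2"
      using pos by (simp add: field_simps)
    then show "2 ^ Suc j * (1 / g (2 ^ (2 ^ Suc j))) \<le> 1 / g (2 ^ j) / 2"
      by (simp add: N_def)
  qed
qed

section \<open>From the Poincare inequality to doubling\<close>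

text \<open>The cutoff is at most 1 and vanishes off a set of at most half the measure of
  \<open>ball x R\<close>, so its average there is at most 1/2. Hence it differs from the average by
  at least 1/2 on \<open>ball x r\<^sub>1\<close>, which is the source of the factor 2.\<close>

lemma Poincare_cutoff:
  fixes \<mu> :: "'a::metric_space measure"
  assumes \<mu>: "metric_measure_space \<mu>"
    and NX: "banach_function_norm (lebesgue_interval \<mu>) Xbar"
    and NY: "banach_function_norm (lebesgue_interval \<mu>) Ybar"
    and C: "0 \<le> C" "1 \<le> \<sigma>"
    and P: "\<And>f \<rho>. f \<in> L1_loc \<mu> \<Longrightarrow> upper_gradient f \<rho> \<Longrightarrow>
      ball_norm \<mu> Xbar (ball x R) (\<lambda>y. ennreal \<bar>f y - average \<mu> (ball x R) f\<bar>)
        \<le> ennreal (C * R) * ball_norm \<mu> Ybar (ball x (\<sigma> * R)) \<rho>"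
    and r: "0 < r\<^sub>1" "r\<^sub>1 < r\<^sub>2" "r\<^sub>2 \<le> R"
    and small: "measure \<mu> (ball x r\<^sub>2) \<le> measure \<mu> (ball x R) / 2"
  shows "fundamental_function Xbar (measure \<mu> (ball x r\<^sub>1) / measure \<mu> (ball x R))
    \<le> 2 * C * R / (r\<^sub>2 - r\<^sub>1) * fundamental_function Ybar (measure \<mu> (ball x r\<^sub>2) / measure \<mu> (ball x R))"
proof -
  let ?B = "ball x R" and ?f = "cutoff x r\<^sub>1 r\<^sub>2" and ?c = "1 / (r\<^sub>2 - r\<^sub>1)"
  define A where "A = average \<mu> ?B ?f"
  have sets: "sets \<mu> = sets borel" using \<mu> by (simp add: metric_measure_space_def)
  have ball: "ball y s \<in> sets \<mu>" for y s by (simp add: sets)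
  have fin: "emeasure \<mu> (ball y s) < \<infinity>" if "s > 0" for y s
    using \<mu> that by (simp add: metric_measure_space_def)
  have pos: "0 < measure \<mu> (ball y s)" if "s > 0" for y s
    using \<mu> fin[OF that, of y] that unfolding metric_measure_space_def measure_def
    by (simp add: enn2real_positive_iff)
  have R: "0 < R" "R \<le> \<sigma> * R" using r C by auto
  have "continuous_on UNIV ?f"
    unfolding cutoff_def using r by (intro continuous_intros) auto
  then have "?f \<in> borel_measurable borel" by (rule borel_measurable_continuous_onI)
  then have f_meas: "?f \<in> borel_measurable \<mu>" using sets measurable_cong_sets by blast
  have f01: "0 \<le> ?f y" "?f y \<le> 1" for y by (auto simp: cutoff_def)
  have f_zero: "?f y = 0" if "y \<notin> ball x r\<^sub>2" for y
    using that r by (auto simp: cutoff_def divide_nonpos_pos)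
  have f_one: "?f y = 1" if "y \<in> ball x r\<^sub>1" for y
    using that r by (auto simp: cutoff_def)
  have int: "set_integrable \<mu> (ball y s) ?f" if "s > 0" for y s
    unfolding set_integrable_def
    by (rule integrableI_bounded_set_indicator[where B = 1]) (use ball fin[OF that] f_meas f01 in auto)
  then have L1: "?f \<in> L1_loc \<mu>" using f_meas by (simp add: L1_loc_def)
  have "(LINT y:?B|\<mu>. ?f y) \<le> (LINT y|\<mu>. indicator (ball x r\<^sub>2) y)"
    unfolding set_lebesgue_integral_def
  proof (rule integral_mono)
    show "integrable \<mu> (\<lambda>y. indicator ?B y *\<^sub>R ?f y)"
      using int[of R x] R by (simp add: set_integrable_def)
    show "integrable \<mu> (indicator (ball x r\<^sub>2) :: 'a \<Rightarrow> real)"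
      using ball fin r by (simp add: integrable_indicator_iff)
    show "indicator ?B y *\<^sub>R ?f y \<le> indicator (ball x r\<^sub>2) y" for y
      using f01[of y] f_zero[of y] by (auto simp: indicator_def)
  qed
  also have "\<dots> = measure \<mu> (ball x r\<^sub>2)" using ball sets.sets_into_space[OF ball] by (simp add: Int_absorb1)
  finally have A_le: "A \<le> 1 / 2"
    using small pos[of R x] R by (simp add: A_def average_def field_simps)
  have rhs: "ball_norm \<mu> Ybar (ball x (\<sigma> * R)) (\<lambda>y. ennreal ?c * indicator (ball x r\<^sub>2) y)
      \<le> ennreal (?c * fundamental_function Ybar (measure \<mu> (ball x r\<^sub>2) / measure \<mu> ?B))"
  proof (rule ball_norm_le[OF NY])
    show "measure \<mu> ?B \<le> measure \<mu> (ball x (\<sigma> * R))"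
      using ball fin[of "\<sigma> * R" x] R
      by (intro measure_mono_fmeasurable subset_ball) (auto simp: fmeasurable_def)
  qed (use ball fin pos R r in auto)
  have "ennreal (1 / 2 * fundamental_function Xbar (measure \<mu> (ball x r\<^sub>1) / measure \<mu> ?B))
      \<le> ball_norm \<mu> Xbar ?B (\<lambda>y. ennreal \<bar>?f y - A\<bar>)"
  proof (rule ball_norm_ge[OF NX])
    show "ennreal (1 / 2) \<le> ennreal \<bar>?f y - A\<bar>" if "y \<in> ball x r\<^sub>1" for y
      using f_one[OF that] A_le by (intro ennreal_leI) simp
    show "(\<lambda>y. ennreal \<bar>?f y - A\<bar>) \<in> borel_measurable \<mu>" using f_meas by measurable
  qed (use ball fin pos R r in auto)
  also have "\<dots> \<le> ennreal (C * R) *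
      ball_norm \<mu> Ybar (ball x (\<sigma> * R)) (\<lambda>y. ennreal ?c * indicator (ball x r\<^sub>2) y)"
    unfolding A_def using r by (intro P L1 upper_gradient_cutoff)
  also have "\<dots> \<le> ennreal (C * R) *
      ennreal (?c * fundamental_function Ybar (measure \<mu> (ball x r\<^sub>2) / measure \<mu> ?B))"
    by (intro mult_left_mono rhs) simp
  also have "\<dots> = ennreal (C * R * (?c * fundamental_function Ybar (measure \<mu> (ball x r\<^sub>2) / measure \<mu> ?B)))"
    using C R by (intro ennreal_mult'[symmetric]) simp
  finally have "ennreal (1 / 2 * fundamental_function Xbar (measure \<mu> (ball x r\<^sub>1) / measure \<mu> ?B))
      \<le> ennreal (C * R * (?c * fundamental_function Ybar (measure \<mu> (ball x r\<^sub>2) / measure \<mu> ?B)))" .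
  moreover have "0 \<le> fundamental_function Ybar s" for s by (simp add: fundamental_function_def)
  ultimately have "1 / 2 * fundamental_function Xbar (measure \<mu> (ball x r\<^sub>1) / measure \<mu> ?B)
      \<le> C * R * (?c * fundamental_function Ybar (measure \<mu> (ball x r\<^sub>2) / measure \<mu> ?B))"
    using C R r by (subst (asm) ennreal_le_iff) auto
  then show ?thesis by (simp add: mult_ac)
qed

theorem theorem5:
  fixes \<mu> :: "'a::metric_space measure"
    and X Y :: "('a \<Rightarrow> ennreal) \<Rightarrow> ennreal"
    and Xbar Ybar :: "(real \<Rightarrow> ennreal) \<Rightarrow> ennreal"
    and \<Psi> g :: "real \<Rightarrow> real"
  assumes "metric_measure_space \<mu>"
    and "ri_norm \<mu> X" and "representation_norm \<mu> X Xbar" and "normalized_fundamental \<mu> Xbar"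
    and "ri_norm \<mu> Y" and "representation_norm \<mu> Y Ybar" and "normalized_fundamental \<mu> Ybar"
    and "\<And>t. \<Psi> t = fundamental_function Xbar t / fundamental_function Ybar t"
    and "continuous_on {1..} g" and "mono_on {1..} g" and "\<And>t. t \<ge> 1 \<Longrightarrow> g t \<ge> 1" and "g 1 = 1"
    and "\<And>t. t \<ge> 1 \<Longrightarrow> \<Psi> (1 / t) \<ge> g t"
    and "((\<lambda>t. t * g t / g (exp t)) \<longlongrightarrow> 0) at_top"
    and "admits_Poincare \<mu> Xbar Ybar"
  shows "doubling_measure \<mu>"
proof -
  let ?\<phi>X = "fundamental_function Xbar" and ?\<phi>Y = "fundamental_function Ybar"
  note \<mu> = assms(1) and \<Psi> = assms(8) and g_mono = assms(10) and g_ge1 = assms(11) and \<Psi>_ge = assms(13)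
  have NX: "banach_function_norm (lebesgue_interval \<mu>) Xbar"
    using assms(3) by (simp add: representation_norm_def ri_norm_def)
  have NY: "banach_function_norm (lebesgue_interval \<mu>) Ybar"
    using assms(6) by (simp add: representation_norm_def ri_norm_def)
  obtain C \<sigma> where C: "1 \<le> C" "1 \<le> \<sigma>"
    and P: "\<And>x r f \<rho>. 0 < r \<Longrightarrow> f \<in> L1_loc \<mu> \<Longrightarrow> upper_gradient f \<rho> \<Longrightarrow>
      ball_norm \<mu> Xbar (ball x r) (\<lambda>y. ennreal \<bar>f y - average \<mu> (ball x r) f\<bar>)
        \<le> ennreal (C * r) * ball_norm \<mu> Ybar (ball x (\<sigma> * r)) \<rho>"
    using assms(15) unfolding admits_Poincare_def by blast
  define b where "b n = 1 / g (2 ^ n)" for n :: nat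
  have b_pos: "0 < b n" for n using g_ge1[of "2 ^ n"] by (simp add: b_def)
  have summable: "summable b"
    unfolding b_def using g_mono g_ge1 assms(14) by (rule summable_inverse_if_superlogarithmic)
  \<comment> \<open>The radii below multiply the tail by \<open>8 * C * r\<close>, so this bound
    keeps the total drop under \<open>r / 2\<close>.\<close>
  have "0 < 1 / (16 * C)" using C by simp
  from suminf_exist_split[OF this summable] obtain K0
    where K0: "\<And>n. K0 \<le> n \<Longrightarrow> norm (\<Sum>i. b (i + n)) < 1 / (16 * C)" by blast
  \<comment> \<open>The successor ensures \<open>1 \<le> K\<close>, so that all ratios
    \<open>m u\<close> below are at most 1/2, as \<open>Poincare_cutoff\<close> requires.\<close>
  define K where "K = Suc K0"
  have tail: "(\<Sum>i<n. b (i + K)) < 1 / (16 * C)" for n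
  proof -
    have "(\<Sum>i<n. b (i + K)) \<le> (\<Sum>i. b (i + K))"
      using summable b_pos by (intro sum_le_suminf) (auto intro: less_imp_le)
    also have "\<dots> < 1 / (16 * C)" using K0[of K] by (simp add: K_def)
    finally show ?thesis .
  qed
  have "emeasure \<mu> (ball x (2 * r)) \<le> ennreal (2 ^ K) * emeasure \<mu> (ball x r)" if r: "0 < r" for x r
  proof -
    define V where "V s = measure \<mu> (ball x s)" for s
    define m where "m s = V s / V (2 * r)" for s
    have sets: "sets \<mu> = sets borel" using \<mu> by (simp add: metric_measure_space_def)
    have fin: "emeasure \<mu> (ball x s) < \<infinity>" if "s > 0" for s
      using \<mu> that by (simp add: metric_measure_space_def)
    have em: "emeasure \<mu> (ball x s) = ennreal (V s)" if "s > 0" for s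
      using fin[OF that] by (simp add: V_def emeasure_eq_ennreal_measure less_top)
    have pos: "0 < V s" if "s > 0" for s
      using \<mu> em[OF that] that by (metis ennreal_less_zero_iff metric_measure_space_def)
    have V_mono: "V s \<le> V t" if "0 < t" "s \<le> t" for s t
      unfolding V_def using fin[of t] that sets
      by (intro measure_mono_fmeasurable) (auto simp: fmeasurable_def)
    have m_pos: "0 < m s" if "s > 0" for s using pos that r by (simp add: m_def)
    have m_mono: "m s \<le> m t" if "0 < t" "s \<le> t" for s t
      using V_mono[OF that] pos[of "2 * r"] r by (simp add: m_def divide_right_mono)
    have "V (2 * r) \<le> 2 ^ K * V r"
    proof (rule ccontr)
      assume "\<not> V (2 * r) \<le> 2 ^ K * V r"
      then have start: "m r \<le> 1 / 2 ^ K" using pos[of "2 * r"] r by (simp add: m_def field_simps)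
      define \<rho> where "\<rho> n = r - 8 * C * r * (\<Sum>i<n. b (i + K))" for n
      have \<rho>_gt: "r / 2 < \<rho> n" for n
        using mult_strict_left_mono[OF tail[of n], of "8 * C * r"] C r by (simp add: \<rho>_def)
      have \<rho>_le: "\<rho> n \<le> r" for n
        using C r b_pos by (simp add: \<rho>_def sum_nonneg less_imp_le)
      have decay: "m (\<rho> n) \<le> 1 / 2 ^ (n + K)" for n
      proof (induction n)
        case 0
        then show ?case using start by (simp add: \<rho>_def)
      next
        case (Suc n)
        define G where "G = g (2 ^ (n + K))"
        define u where "u = \<rho> n"
        define v where "v = \<rho> (Suc n)"
        have G: "1 \<le> G" using g_ge1 by (simp add: G_def)
        have uv: "u - v = 8 * C * r / G"
          by (simp add: u_def v_def \<rho>_def b_def G_def algebra_simps)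
        moreover have "0 < 8 * C * r / G" using C r G by simp
        ultimately have "v < u" by simp
        have bounds: "0 < v" "0 < u" "u \<le> r"
          using \<rho>_gt[of n] \<rho>_gt[of "Suc n"] \<rho>_le[of n] r by (auto simp: u_def v_def)
        have mu: "m u \<le> 1 / 2 ^ (n + K)" using Suc by (simp add: u_def)
        also have "(1::real) / 2 ^ (n + K) \<le> 1 / 2 ^ 1"
          by (intro divide_left_mono power_increasing) (auto simp: K_def)
        finally have "V u \<le> V (2 * r) / 2" using pos[of "2 * r"] r by (simp add: m_def field_simps)
        then have "?\<phi>X (m v) \<le> 2 * C * (2 * r) / (u - v) * ?\<phi>Y (m u)"
          unfolding m_def V_def using C r bounds \<open>v < u\<close>
          by (intro Poincare_cutoff[OF \<mu> NX NY, of C \<sigma>] P) auto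
        \<comment> \<open>The factor 8 in the radii is made for this: 4 C r divided by 8 C r / G is
          G / 2.\<close>
        also have "2 * C * (2 * r) / (u - v) = G / 2"
          unfolding uv using C r G by (simp add: field_simps)
        finally have upper: "?\<phi>X (m v) \<le> G / 2 * ?\<phi>Y (m u)" .
        have v_le: "m v \<le> m u" using m_mono bounds \<open>v < u\<close> by simp
        \<comment> \<open>A small ratio \<open>m v\<close> has a large reciprocal, so monotonicity
          of \<open>g\<close> bounds \<Psi> at \<open>m v\<close> from below by
          \<open>G\<close>.\<close>
        have inv: "2 ^ (n + K) \<le> 1 / m v"
          using order_trans[OF v_le mu] m_pos[of v] bounds by (simp add: field_simps)
        have one: "1 \<le> 1 / m v" by (rule order_trans[OF _ inv]) simp
        have "G \<le> g (1 / m v)"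
          unfolding G_def using inv one by (intro monotone_onD[OF g_mono]) simp_all
        also have "\<dots> \<le> ?\<phi>X (m v) / ?\<phi>Y (m v)"
          using \<Psi>_ge[of "1 / m v"] one by (simp add: \<Psi>)
        finally have ratio: "G \<le> ?\<phi>X (m v) / ?\<phi>Y (m v)" .
        \<comment> \<open>Division by zero yields 0, so a quotient of at least 1 has a nonzero
          denominator.\<close>
        then have "?\<phi>Y (m v) \<noteq> 0" using G by auto
        moreover have nonneg: "0 \<le> ?\<phi>Y s" for s by (simp add: fundamental_function_def)
        ultimately have Y_pos: "0 < ?\<phi>Y (m v)" by (simp add: less_le)
        then have "G * ?\<phi>Y (m v) \<le> G * (?\<phi>Y (m u) / 2)"
          using ratio upper by (simp add: field_simps)
        then have Y_half: "?\<phi>Y (m v) \<le> ?\<phi>Y (m u) / 2"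
          using G by (subst (asm) mult_le_cancel_left_pos) auto
        \<comment> \<open>The quotient of the fundamental function by its argument does not
          increase, so halving the function at least halves the argument.\<close>
        have "m v * ?\<phi>Y (m u) \<le> m u * ?\<phi>Y (m v)"
          using m_pos[OF bounds(1)] v_le
          by (rule fundamental_function_quasi_concave[OF NY assms(7)])
        also have "\<dots> \<le> m u * (?\<phi>Y (m u) / 2)"
          using Y_half m_pos[OF bounds(2)] by (intro mult_left_mono) auto
        finally have "m v * ?\<phi>Y (m u) \<le> m u / 2 * ?\<phi>Y (m u)" by simp
        moreover have "0 < ?\<phi>Y (m u)" using Y_pos Y_half by simp
        ultimately have "m v \<le> m u / 2" by (subst (asm) mult_le_cancel_right_pos)
        also have "\<dots> \<le> 1 / 2 ^ (Suc n + K)" using mu by simp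
        finally show ?case by (simp add: v_def)
      qed
      \<comment> \<open>All the radii exceed \<open>r / 2\<close>, so \<open>decay\<close> would
        bound this fixed positive number by every power of 1/2.\<close>
      have "0 < m (r / 2)" using m_pos r by simp
      then obtain n where n: "(1 / 2) ^ n < m (r / 2)"
        using real_arch_pow_inv[of "m (r / 2)" "1 / 2"] by auto
      have "m (r / 2) \<le> m (\<rho> n)" using \<rho>_gt[of n] r by (intro m_mono) auto
      also have "\<dots> \<le> (1 / 2) ^ (n + K)" using decay[of n] by (simp add: power_one_over)
      also have "\<dots> \<le> (1 / 2) ^ n" by (intro power_decreasing) auto
      finally show False using n by simp
    qed
    then have "ennreal (V (2 * r)) \<le> ennreal (2 ^ K) * ennreal (V r)"
      by (simp add: ennreal_leI V_def flip: ennreal_mult)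
    then show ?thesis using em r by simp
  qed
  then show ?thesis
    unfolding doubling_measure_def by (intro exI[of _ "2 ^ K"]) simp
qed

end
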